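(* Let $\Sigma$ be a fixed finite first-order signature (without equality) containing at least one constant. Let $M$ be a finite set of linear atoms with disequality constraints over $\Sigma$, or a finite set of linear implicit generalizations over $\Sigma$, or a finite set of linear atoms with membership constraints over $\Sigma$. Let $\mathcal{I}$ be the Herbrand interpretation over $\Sigma$ consisting of all ground atoms generated by the elements of $M$. Then every clause set $N$ over $\Sigma$ with $\mathcal{I} \models N$ has a model with a finite domain. (That is, none of these three formalisms can represent a model of a clause set that has only infinite models.)
   Context: A term or atom is linear if no variable occurs in it more than once. A Herbrand interpretation is identified with the set of ground atoms that are true in it; its domain is the set of all ground terms. A clause set is a set of universally quantified disjunctions of literals. A linear atom with disequality constraints (ADC) has the form $(A : x_1 \neq t_1, \ldots, x_n \neq t_n)$ where the variables $x_i$ are pairwise different and occur in the atom $A$, no $x_i$ occurs in any $t_j$, the variables of the $t_j$ do not occur in $A$, and $A$ and all terms $t_j$ are linear. It generates all ground atoms $A\sigma$ such that there is no substitution $\delta$ with $x_i\sigma = t_i\delta$ for some $i$. A linear implicit generalization (IG) is an expression $A/\{B_1,\ldots,B_n\}$ where $A$ and all $B_i$ are linear atoms. It generates every ground instance of $A$ that is not an instance of any $B_i$. A (bottom-up, finite) tree automaton consists of a finite set $\mathcal{Q}$ of states, a finite set $\mathcal{O}$ of operators (symbols with arities), a subset $\mathcal{Q}_A \subseteq \mathcal{Q}$ of accepting states, and a finite set of rules $f(q_1,\ldots,q_n) \mapsto q$ with $q, q_i \in \mathcal{Q}$ and $f \in \mathcal{O}$. Inductively, a state $q$ accepts a ground term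 $f(t_1,\ldots,t_n)$ if there is a rule $f(q_1,\ldots,q_n)\mapsto q$ such that $q_i$ accepts $t_i$ for all $i$. The automaton accepts a term if some accepting state accepts it. A linear atom with membership constraint (AMC) is a pair $A : x \in S$ of a linear atom $A$ and a constraint $x \in S$, where $x$ is a variable occurring in $A$ and $S$ is represented by a tree automaton over the function symbols of $\Sigma$. It generates all ground instances $A\sigma$ such that $x\sigma$ is accepted by the tree automaton representing $S$. *)

theory Defs
  imports Main
begin

datatype ('f, 'v) trm = Var 'v | Fun 'f "('f, 'v) trm list"

datatype ('f, 'p, 'v) atom = Atom 'p "('f, 'v) trm list"

datatype ('f, 'p, 'v) literal = Pos "('f, 'p, 'v) atom" | Neg "('f, 'p, 'v) atom"

record ('f, 'p) sig =
  funs :: "'f set"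
  preds :: "'p set"
  fun_arity :: "'f \<Rightarrow> nat"
  pred_arity :: "'p \<Rightarrow> nat"

definition finite_sig_with_constant :: "('f, 'p) sig \<Rightarrow> bool" where
  "finite_sig_with_constant \<Sigma> \<longleftrightarrow>
     finite (funs \<Sigma>) \<and> finite (preds \<Sigma>) \<and> (\<exists>c \<in> funs \<Sigma>. fun_arity \<Sigma> c = 0)"


(* Variable occurrences from left to right, with repetitions. *)

fun trm_var_occs :: "('f, 'v) trm \<Rightarrow> 'v list" where
  "trm_var_occs (Var x) = [x]"
| "trm_var_occs (Fun f ts) = concat (map trm_var_occs ts)"

fun atom_var_occs :: "('f, 'p, 'v) atom \<Rightarrow> 'v list" where
  "atom_var_occs (Atom p ts) = concat (map trm_var_occs ts)"

definition trm_vars :: "('f, 'v) trm \<Rightarrow> 'v set" where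
  "trm_vars t = set (trm_var_occs t)"

definition atom_vars :: "('f, 'p, 'v) atom \<Rightarrow> 'v set" where
  "atom_vars A = set (atom_var_occs A)"

definition linear_trm :: "('f, 'v) trm \<Rightarrow> bool" where
  "linear_trm t \<longleftrightarrow> distinct (trm_var_occs t)"

definition linear_atom :: "('f, 'p, 'v) atom \<Rightarrow> bool" where
  "linear_atom A \<longleftrightarrow> distinct (atom_var_occs A)"

fun trm_over :: "('f, 'p) sig \<Rightarrow> ('f, 'v) trm \<Rightarrow> bool" where
  "trm_over \<Sigma> (Var x) \<longleftrightarrow> True"
| "trm_over \<Sigma> (Fun f ts) \<longleftrightarrow>
     f \<in> funs \<Sigma> \<and> length ts = fun_arity \<Sigma> f \<and> (\<forall>t \<in> set ts. trm_over \<Sigma> t)"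

fun atom_over :: "('f, 'p) sig \<Rightarrow> ('f, 'p, 'v) atom \<Rightarrow> bool" where
  "atom_over \<Sigma> (Atom p ts) \<longleftrightarrow>
     p \<in> preds \<Sigma> \<and> length ts = pred_arity \<Sigma> p \<and> (\<forall>t \<in> set ts. trm_over \<Sigma> t)"

fun literal_over :: "('f, 'p) sig \<Rightarrow> ('f, 'p, 'v) literal \<Rightarrow> bool" where
  "literal_over \<Sigma> (Pos A) \<longleftrightarrow> atom_over \<Sigma> A"
| "literal_over \<Sigma> (Neg A) \<longleftrightarrow> atom_over \<Sigma> A"

definition ground_trms :: "('f, 'p) sig \<Rightarrow> ('f, 'v) trm set" where
  "ground_trms \<Sigma> = {t. trm_over \<Sigma> t \<and> trm_vars t = {}}"

definition ground_atoms :: "('f, 'p) sig \<Rightarrow> ('f, 'p, 'v) atom set" where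
  "ground_atoms \<Sigma> = {A. atom_over \<Sigma> A \<and> atom_vars A = {}}"

fun subst_trm :: "('v \<Rightarrow> ('f, 'v) trm) \<Rightarrow> ('f, 'v) trm \<Rightarrow> ('f, 'v) trm" where
  "subst_trm \<sigma> (Var x) = \<sigma> x"
| "subst_trm \<sigma> (Fun f ts) = Fun f (map (subst_trm \<sigma>) ts)"

fun subst_atom :: "('v \<Rightarrow> ('f, 'v) trm) \<Rightarrow> ('f, 'p, 'v) atom \<Rightarrow> ('f, 'p, 'v) atom" where
  "subst_atom \<sigma> (Atom p ts) = Atom p (map (subst_trm \<sigma>) ts)"

definition ground_instances ::
    "('f, 'p) sig \<Rightarrow> ('f, 'p, 'v) atom \<Rightarrow> ('f, 'p, 'v) atom set" where
  "ground_instances \<Sigma> A = {subst_atom \<sigma> A | \<sigma>. subst_atom \<sigma> A \<in> ground_atoms \<Sigma>}"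


(* A clause is the disjunction of the literals in a finite set; its variables are implicitly
   universally quantified. A clause set may be infinite. *)

definition clause_set_over :: "('f, 'p) sig \<Rightarrow> ('f, 'p, 'v) literal set set \<Rightarrow> bool" where
  "clause_set_over \<Sigma> N \<longleftrightarrow> (\<forall>C \<in> N. finite C \<and> (\<forall>L \<in> C. literal_over \<Sigma> L))"

record ('f, 'p, 'd) interp =
  dom :: "'d set"
  fun_interp :: "'f \<Rightarrow> 'd list \<Rightarrow> 'd"
  pred_interp :: "'p \<Rightarrow> 'd list \<Rightarrow> bool"

definition interp_over :: "('f, 'p) sig \<Rightarrow> ('f, 'p, 'd) interp \<Rightarrow> bool" where
  "interp_over \<Sigma> \<M> \<longleftrightarrow> dom \<M> \<noteq> {} \<and>
     (\<forall>f \<in> funs \<Sigma>. \<forall>ds. length ds = fun_arity \<Sigma> f \<and> set ds \<subseteq> dom \<M>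
        \<longrightarrow> fun_interp \<M> f ds \<in> dom \<M>)"

fun trm_value :: "('f, 'p, 'd) interp \<Rightarrow> ('v \<Rightarrow> 'd) \<Rightarrow> ('f, 'v) trm \<Rightarrow> 'd" where
  "trm_value \<M> \<nu> (Var x) = \<nu> x"
| "trm_value \<M> \<nu> (Fun f ts) = fun_interp \<M> f (map (trm_value \<M> \<nu>) ts)"

fun atom_true :: "('f, 'p, 'd) interp \<Rightarrow> ('v \<Rightarrow> 'd) \<Rightarrow> ('f, 'p, 'v) atom \<Rightarrow> bool" where
  "atom_true \<M> \<nu> (Atom p ts) \<longleftrightarrow> pred_interp \<M> p (map (trm_value \<M> \<nu>) ts)"

fun literal_true :: "('f, 'p, 'd) interp \<Rightarrow> ('v \<Rightarrow> 'd) \<Rightarrow> ('f, 'p, 'v) literal \<Rightarrow> bool" where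
  "literal_true \<M> \<nu> (Pos A) \<longleftrightarrow> atom_true \<M> \<nu> A"
| "literal_true \<M> \<nu> (Neg A) \<longleftrightarrow> \<not> atom_true \<M> \<nu> A"

definition satisfies :: "('f, 'p, 'd) interp \<Rightarrow> ('f, 'p, 'v) literal set set \<Rightarrow> bool" where
  "satisfies \<M> N \<longleftrightarrow>
     (\<forall>C \<in> N. \<forall>\<nu>. range \<nu> \<subseteq> dom \<M> \<longrightarrow> (\<exists>L \<in> C. literal_true \<M> \<nu> L))"

definition herbrand ::
    "('f, 'p) sig \<Rightarrow> ('f, 'p, 'v) atom set \<Rightarrow> ('f, 'p, ('f, 'v) trm) interp" where
  "herbrand \<Sigma> I =
     \<lparr>dom = ground_trms \<Sigma>, fun_interp = Fun, pred_interp = (\<lambda>p ts. Atom p ts \<in> I)\<rparr>"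


(* The pair (A, [(x1, t1), ..., (xn, tn)]) stands for (A : x1 \<noteq> t1, ..., xn \<noteq> tn). *)

type_synonym ('f, 'p, 'v) adc = "('f, 'p, 'v) atom \<times> ('v \<times> ('f, 'v) trm) list"

definition linear_adc :: "('f, 'p) sig \<Rightarrow> ('f, 'p, 'v) adc \<Rightarrow> bool" where
  "linear_adc \<Sigma> = (\<lambda>(A, cs).
     atom_over \<Sigma> A \<and> linear_atom A \<and>
     distinct (map fst cs) \<and>
     (\<forall>(x, t) \<in> set cs. x \<in> atom_vars A \<and> trm_over \<Sigma> t \<and> linear_trm t \<and>
        trm_vars t \<inter> atom_vars A = {}) \<and>
     (\<forall>(x, s) \<in> set cs. \<forall>(y, t) \<in> set cs. x \<notin> trm_vars t))"

(* Nothing is required of \<sigma> and \<delta> beyond the ground atom lying over the signature: this makes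
   \<sigma> ground on the variables of A, and hence \<delta> ground on the variables of t whenever
   t\<delta> = x\<sigma>. *)

definition adc_generated ::
    "('f, 'p) sig \<Rightarrow> ('f, 'p, 'v) adc \<Rightarrow> ('f, 'p, 'v) atom set" where
  "adc_generated \<Sigma> = (\<lambda>(A, cs).
     {subst_atom \<sigma> A | \<sigma>. subst_atom \<sigma> A \<in> ground_atoms \<Sigma> \<and>
        \<not> (\<exists>(x, t) \<in> set cs. \<exists>\<delta>. \<sigma> x = subst_trm \<delta> t)})"


(* The pair (A, Bs) stands for A / Bs. *)

type_synonym ('f, 'p, 'v) ig = "('f, 'p, 'v) atom \<times> ('f, 'p, 'v) atom set"

definition linear_ig :: "('f, 'p) sig \<Rightarrow> ('f, 'p, 'v) ig \<Rightarrow> bool" where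
  "linear_ig \<Sigma> = (\<lambda>(A, Bs).
     atom_over \<Sigma> A \<and> linear_atom A \<and>
     finite Bs \<and> (\<forall>B \<in> Bs. atom_over \<Sigma> B \<and> linear_atom B))"

definition ig_generated :: "('f, 'p) sig \<Rightarrow> ('f, 'p, 'v) ig \<Rightarrow> ('f, 'p, 'v) atom set" where
  "ig_generated \<Sigma> = (\<lambda>(A, Bs).
     {G \<in> ground_instances \<Sigma> A. \<not> (\<exists>B \<in> Bs. \<exists>\<tau>. G = subst_atom \<tau> B)})"


(* A rule (f, [q1, ..., qn], q) stands for f(q1, ..., qn) \<mapsto> q. The operators are not a
   component of the automaton; they are the function symbols of a signature. *)

record ('f, 'q) ta =
  states :: "'q set"
  accepting :: "'q set"
  rules :: "('f \<times> 'q list \<times> 'q) set"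

definition ta_over :: "('f, 'p) sig \<Rightarrow> ('f, 'q) ta \<Rightarrow> bool" where
  "ta_over \<Sigma> T \<longleftrightarrow>
     finite (states T) \<and> accepting T \<subseteq> states T \<and> finite (rules T) \<and>
     (\<forall>(f, qs, q) \<in> rules T. f \<in> funs \<Sigma> \<and> length qs = fun_arity \<Sigma> f \<and>
        set qs \<subseteq> states T \<and> q \<in> states T)"

inductive state_accepts :: "('f, 'q) ta \<Rightarrow> 'q \<Rightarrow> ('f, 'v) trm \<Rightarrow> bool" for T where
  "(f, qs, q) \<in> rules T \<Longrightarrow> list_all2 (state_accepts T) qs ts \<Longrightarrow>
     state_accepts T q (Fun f ts)"

definition ta_accepts :: "('f, 'q) ta \<Rightarrow> ('f, 'v) trm \<Rightarrow> bool" where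
  "ta_accepts T t \<longleftrightarrow> (\<exists>q \<in> accepting T. state_accepts T q t)"


(* The triple (A, x, T) stands for A : x \<in> S, where S is the set of terms accepted by T. *)

type_synonym ('f, 'p, 'v, 'q) amc = "('f, 'p, 'v) atom \<times> 'v \<times> ('f, 'q) ta"

definition linear_amc :: "('f, 'p) sig \<Rightarrow> ('f, 'p, 'v, 'q) amc \<Rightarrow> bool" where
  "linear_amc \<Sigma> = (\<lambda>(A, x, T).
     atom_over \<Sigma> A \<and> linear_atom A \<and> x \<in> atom_vars A \<and> ta_over \<Sigma> T)"

definition amc_generated ::
    "('f, 'p) sig \<Rightarrow> ('f, 'p, 'v, 'q) amc \<Rightarrow> ('f, 'p, 'v) atom set" where
  "amc_generated \<Sigma> = (\<lambda>(A, x, T).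
     {subst_atom \<sigma> A | \<sigma>. subst_atom \<sigma> A \<in> ground_atoms \<Sigma> \<and> ta_accepts T (\<sigma> x)})"


(* A finite domain can always be renamed to a set of natural numbers, so fixing the element
   type to nat loses no finite models. *)

definition has_finite_model :: "('f, 'p) sig \<Rightarrow> ('f, 'p, 'v) literal set set \<Rightarrow> bool" where
  "has_finite_model \<Sigma> N \<longleftrightarrow>
     (\<exists>\<M> :: ('f, 'p, nat) interp. interp_over \<Sigma> \<M> \<and> finite (dom \<M>) \<and> satisfies \<M> N)"

end

theory Submission
  imports Defs
begin

text \<open>Each generated set is recognizable: there is a congruence of finite index on the ground terms
  such that membership of a ground atom depends only on the classes of its arguments. For the
  instances of a linear term or atom this holds because linearity makes matching a conjunction of
  independent conditions on the arguments; the constraints of the three formalisms only add Boolean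
  combinations. The quotient of the Herbrand interpretation by such a congruence is finite, and since
  valuations in the quotient lift to ground substitutions, it satisfies every clause that the
  Herbrand interpretation satisfies.\<close>

text \<open>Moves an argumentwise condition \<open>P\<close> along an argumentwise relation
  \<open>E\<close>. The restriction to members of \<open>us\<close> matters: later \<open>P\<close>
  is known to respect \<open>E\<close> only for the patterns or states listed in
  \<open>us\<close>.\<close>

lemma list_all2_transfer_left:
  assumes "list_all2 E ts ss" and "list_all2 P us ts"
    and "\<And>u s t. u \<in> set us \<Longrightarrow> E t s \<Longrightarrow> P u t \<Longrightarrow> P u s"
  shows "list_all2 P us ss"
  using assms by (auto simp: list_all2_conv_all_nth)


section \<open>Recognizable sets of ground terms and atoms\<close>

text \<open>Groundness of both sides is built in, so this is an equivalence relation exactly on the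
  ground terms. A finite \<open>F\<close> yields at most 2^|F| classes, and the empty
  \<open>F\<close> relates all ground terms.\<close>

definition indist :: "('f, 'p) sig \<Rightarrow> ('f, 'v) trm set set \<Rightarrow> ('f, 'v) trm \<Rightarrow> ('f, 'v) trm \<Rightarrow> bool"
  where "indist \<Sigma> F s t \<longleftrightarrow>
    s \<in> ground_trms \<Sigma> \<and> t \<in> ground_trms \<Sigma> \<and> (\<forall>L \<in> F. s \<in> L \<longleftrightarrow> t \<in> L)"

text \<open>The languages of the states of a complete deterministic automaton form such a family;
  conversely, the sets of languages containing a given term are the states of one.\<close>

definition closed_family :: "('f, 'p) sig \<Rightarrow> ('f, 'v) trm set set \<Rightarrow> bool"
  where "closed_family \<Sigma> F \<longleftrightarrow> finite F \<and>
    (\<forall>f \<in> funs \<Sigma>. \<forall>ts ss. length ts = fun_arity \<Sigma> f \<longrightarrow> list_all2 (indist \<Sigma> F) ts ss \<longrightarrow>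
      indist \<Sigma> F (Fun f ts) (Fun f ss))"

text \<open>The Myhill-Nerode form of regularity: the ground part of \<open>L\<close> is a union of
  classes of a congruence of finite index.\<close>

definition recognizable :: "('f, 'p) sig \<Rightarrow> ('f, 'v) trm set \<Rightarrow> bool"
  where "recognizable \<Sigma> L \<longleftrightarrow>
    (\<exists>F. closed_family \<Sigma> F \<and> (\<forall>s t. indist \<Sigma> F s t \<longrightarrow> (s \<in> L \<longleftrightarrow> t \<in> L)))"

text \<open>Predicates occur only at the root, so respecting the classes of the arguments is all
  that makes them well defined on the quotient.\<close>

definition recognizable_atoms :: "('f, 'p) sig \<Rightarrow> ('f, 'p, 'v) atom set \<Rightarrow> bool"
  where "recognizable_atoms \<Sigma> I \<longleftrightarrow>
    (\<exists>F. closed_family \<Sigma> F \<and> (\<forall>p ts ss. list_all2 (indist \<Sigma> F) ts ss \<longrightarrow>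
      (Atom p ts \<in> I \<longleftrightarrow> Atom p ss \<in> I)))"

lemma indist_mono: "indist \<Sigma> F s t \<Longrightarrow> F' \<subseteq> F \<Longrightarrow> indist \<Sigma> F' s t"
  unfolding indist_def by blast

lemma indist_sym: "indist \<Sigma> F s t \<Longrightarrow> indist \<Sigma> F t s"
  unfolding indist_def by blast

lemma list_all2_indist_mono:
  "list_all2 (indist \<Sigma> F) ts ss \<Longrightarrow> F' \<subseteq> F \<Longrightarrow> list_all2 (indist \<Sigma> F') ts ss"
  by (erule list_all2_mono) (rule indist_mono)

lemma list_all2_indist_sym:
  "list_all2 (indist \<Sigma> F) ts ss \<Longrightarrow> list_all2 (indist \<Sigma> F) ss ts"
  by (auto simp: list_all2_conv_all_nth intro: indist_sym)

lemma list_all2_indist_ground: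
  assumes "list_all2 (indist \<Sigma> F) ts ss"
  shows "set ts \<subseteq> ground_trms \<Sigma>" and "set ss \<subseteq> ground_trms \<Sigma>"
  using assms by (auto simp: list_all2_conv_all_nth set_conv_nth indist_def)

lemma Fun_ground_iff:
  "Fun f ts \<in> ground_trms \<Sigma> \<longleftrightarrow>
    f \<in> funs \<Sigma> \<and> length ts = fun_arity \<Sigma> f \<and> set ts \<subseteq> ground_trms \<Sigma>"
  by (auto simp: ground_trms_def trm_vars_def)

lemma Atom_ground_iff:
  "Atom p ts \<in> ground_atoms \<Sigma> \<longleftrightarrow>
    p \<in> preds \<Sigma> \<and> length ts = pred_arity \<Sigma> p \<and> set ts \<subseteq> ground_trms \<Sigma>"
  by (auto simp: ground_atoms_def ground_trms_def atom_vars_def trm_vars_def)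

lemma closed_family_finite: "closed_family \<Sigma> F \<Longrightarrow> finite F"
  by (simp add: closed_family_def)

lemma closed_familyD:
  "closed_family \<Sigma> F \<Longrightarrow> list_all2 (indist \<Sigma> F) ts ss \<Longrightarrow> f \<in> funs \<Sigma> \<Longrightarrow>
    length ts = fun_arity \<Sigma> f \<Longrightarrow> indist \<Sigma> F (Fun f ts) (Fun f ss)"
  by (simp add: closed_family_def)

text \<open>One implication per language suffices, since indistinguishability of argument lists is
  symmetric.\<close>

lemma closed_familyI:
  assumes "finite F"
    and "\<And>L f ts ss. L \<in> F \<Longrightarrow> f \<in> funs \<Sigma> \<Longrightarrow> length ts = fun_arity \<Sigma> f \<Longrightarrow>
      list_all2 (indist \<Sigma> F) ts ss \<Longrightarrow> Fun f ts \<in> L \<Longrightarrow> Fun f ss \<in> L"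
  shows "closed_family \<Sigma> F"
  unfolding closed_family_def
proof (intro conjI ballI allI impI)
  show "finite F" by fact
next
  fix f ts ss
  assume f: "f \<in> funs \<Sigma>" and len: "length ts = fun_arity \<Sigma> f"
    and E: "list_all2 (indist \<Sigma> F) ts ss"
  have len': "length ss = fun_arity \<Sigma> f"
    using len list_all2_lengthD[OF E] by simp
  have "Fun f ts \<in> L \<longleftrightarrow> Fun f ss \<in> L" if "L \<in> F" for L
    using assms(2)[OF that f len E] assms(2)[OF that f len' list_all2_indist_sym[OF E]] by blast
  then show "indist \<Sigma> F (Fun f ts) (Fun f ss)"
    using f len len' list_all2_indist_ground[OF E] by (auto simp: indist_def Fun_ground_iff)
qed

text \<open>A larger family refines the equivalence, so each member language can fall back on the
  closedness of its own family. This is the product construction for automata.\<close>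

lemma closed_family_Union:
  assumes "finite \<F>" and cl: "\<And>F. F \<in> \<F> \<Longrightarrow> closed_family \<Sigma> F"
  shows "closed_family \<Sigma> (\<Union>\<F>)"
proof (rule closed_familyI)
  show "finite (\<Union>\<F>)"
    using assms closed_family_finite by blast
next
  fix L f ts ss
  assume L: "L \<in> \<Union>\<F>" and f: "f \<in> funs \<Sigma>" "length ts = fun_arity \<Sigma> f"
    and E: "list_all2 (indist \<Sigma> (\<Union>\<F>)) ts ss" and ts: "Fun f ts \<in> L"
  from L obtain F where F: "F \<in> \<F>" "L \<in> F" by blast
  then have "list_all2 (indist \<Sigma> F) ts ss"
    using list_all2_indist_mono[OF E] by blast
  then have "indist \<Sigma> F (Fun f ts) (Fun f ss)"
    using closed_familyD[OF cl] F f by blast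
  with F ts show "Fun f ss \<in> L" by (auto simp: indist_def)
qed

text \<open>Adds one new state language that is computed from the old ones at the arguments. The
  premise on \<open>L\<close> refers to the classes of \<open>F\<close> only, not to
  \<open>L\<close> itself.\<close>

lemma closed_family_insert:
  assumes F: "closed_family \<Sigma> F"
    and L: "\<And>f ts ss. f \<in> funs \<Sigma> \<Longrightarrow> length ts = fun_arity \<Sigma> f \<Longrightarrow>
      list_all2 (indist \<Sigma> F) ts ss \<Longrightarrow> Fun f ts \<in> L \<Longrightarrow> Fun f ss \<in> L"
  shows "closed_family \<Sigma> (insert L F)"
proof (rule closed_familyI)
  show "finite (insert L F)"
    using F by (simp add: closed_family_finite)
next
  fix L' f ts ss
  assume L': "L' \<in> insert L F" and f: "f \<in> funs \<Sigma>" "length ts = fun_arity \<Sigma> f"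
    and E: "list_all2 (indist \<Sigma> (insert L F)) ts ss" and ts: "Fun f ts \<in> L'"
  have E': "list_all2 (indist \<Sigma> F) ts ss"
    using list_all2_indist_mono[OF E] by blast
  show "Fun f ss \<in> L'"
    using L' L[OF f E'] closed_familyD[OF F E' f] ts by (auto simp: indist_def)
qed

section \<open>Boolean closure of recognizable sets of terms and atoms\<close>

lemma recognizableI:
  assumes "closed_family \<Sigma> F" and "\<And>s t. indist \<Sigma> F s t \<Longrightarrow> s \<in> L \<Longrightarrow> t \<in> L"
  shows "recognizable \<Sigma> L"
  unfolding recognizable_def using assms indist_sym by blast

lemma recognizable_member_closed:
  assumes "recognizable \<Sigma> L"
  obtains F where "closed_family \<Sigma> F" and "L \<in> F"
proof -
  from assms obtain F where F: "closed_family \<Sigma> F"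
    and L: "\<And>s t. indist \<Sigma> F s t \<Longrightarrow> s \<in> L \<Longrightarrow> t \<in> L"
    unfolding recognizable_def by blast
  have "closed_family \<Sigma> (insert L F)"
    \<comment> \<open>Closedness makes \<open>Fun f ts\<close> and \<open>Fun f ss\<close>
      indistinguishable, and \<open>L\<close> respects that relation.\<close>
    by (rule closed_family_insert[OF F]) (rule L, rule closed_familyD[OF F])
  then show thesis using that by blast
qed

lemma recognizable_subset_closed:
  assumes "finite \<L>" and "\<And>L. L \<in> \<L> \<Longrightarrow> recognizable \<Sigma> L"
  obtains F where "closed_family \<Sigma> F" and "\<L> \<subseteq> F"
proof -
  have "\<exists>F. closed_family \<Sigma> F \<and> L \<in> F" if "L \<in> \<L>" for L
    using recognizable_member_closed[OF assms(2)[OF that]] by blast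
  then obtain F where F: "\<And>L. L \<in> \<L> \<Longrightarrow> closed_family \<Sigma> (F L)" "\<And>L. L \<in> \<L> \<Longrightarrow> L \<in> F L"
    by metis
  have "closed_family \<Sigma> (\<Union>(F ` \<L>))"
    using assms(1) F by (intro closed_family_Union) auto
  moreover have "\<L> \<subseteq> \<Union>(F ` \<L>)" using F by blast
  ultimately show thesis using that by blast
qed

text \<open>Covers all finite Boolean combinations at once: on ground terms, \<open>K\<close> may be
  any function of the membership in the languages of \<open>\<L>\<close>.\<close>

lemma recognizable_determined:
  assumes "finite \<L>" and "\<And>L. L \<in> \<L> \<Longrightarrow> recognizable \<Sigma> L"
    and "\<And>s t. indist \<Sigma> \<L> s t \<Longrightarrow> s \<in> K \<Longrightarrow> t \<in> K"
  shows "recognizable \<Sigma> K"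
proof -
  obtain F where "closed_family \<Sigma> F" and "\<L> \<subseteq> F"
    using recognizable_subset_closed[OF assms(1,2)] by blast
  then show ?thesis
    using assms(3) indist_mono by (intro recognizableI[of _ F]) blast+
qed

lemma recognizable_ground: "recognizable \<Sigma> (ground_trms \<Sigma>)"
  by (rule recognizable_determined[of "{}"]) (auto simp: indist_def)

text \<open>The same Boolean closure for sets of atoms, with one congruence refining those of all
  members of \<open>\<J>\<close>.\<close>

lemma recognizable_atoms_determined:
  assumes "finite \<J>" and rec: "\<And>J. J \<in> \<J> \<Longrightarrow> recognizable_atoms \<Sigma> J"
    and det: "\<And>p ts ss. set ts \<subseteq> ground_trms \<Sigma> \<Longrightarrow> set ss \<subseteq> ground_trms \<Sigma> \<Longrightarrow>
      length ts = length ss \<Longrightarrow> (\<forall>J \<in> \<J>. Atom p ts \<in> J \<longleftrightarrow> Atom p ss \<in> J) \<Longrightarrow>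
      Atom p ts \<in> I \<Longrightarrow> Atom p ss \<in> I"
  shows "recognizable_atoms \<Sigma> I"
proof -
  from rec obtain F where F: "\<And>J. J \<in> \<J> \<Longrightarrow> closed_family \<Sigma> (F J)"
    and resp: "\<And>J p ts ss. J \<in> \<J> \<Longrightarrow> list_all2 (indist \<Sigma> (F J)) ts ss \<Longrightarrow>
      Atom p ts \<in> J \<longleftrightarrow> Atom p ss \<in> J"
    unfolding recognizable_atoms_def by metis
  have cl: "closed_family \<Sigma> (\<Union>(F ` \<J>))"
    using assms(1) F by (intro closed_family_Union) auto
  have imp: "Atom p ss \<in> I"
    if E: "list_all2 (indist \<Sigma> (\<Union>(F ` \<J>))) ts ss" and "Atom p ts \<in> I" for p ts ss
  proof (rule det)
    show "\<forall>J \<in> \<J>. Atom p ts \<in> J \<longleftrightarrow> Atom p ss \<in> J"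
      using resp list_all2_indist_mono[OF E] by blast
  qed (use E that list_all2_indist_ground[OF E] in \<open>auto dest: list_all2_lengthD\<close>)
  then show ?thesis
    unfolding recognizable_atoms_def using cl list_all2_indist_sym by blast
qed

lemma recognizable_atoms_Union:
  assumes "finite \<J>" and "\<And>J. J \<in> \<J> \<Longrightarrow> recognizable_atoms \<Sigma> J"
  shows "recognizable_atoms \<Sigma> (\<Union>\<J>)"
  by (rule recognizable_atoms_determined[OF assms]) auto


section \<open>Instances of linear terms and atoms\<close>

text \<open>The constraint \<open>R\<close> acts on each variable separately. Disequalities and
  membership constraints are later encoded in it; a constant \<open>R\<close> equal to the ground
  terms gives plain ground instances.\<close>

definition trm_instances :: "('v \<Rightarrow> ('f, 'v) trm set) \<Rightarrow> ('f, 'v) trm \<Rightarrow> ('f, 'v) trm set"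
  where "trm_instances R u = {subst_trm \<sigma> u | \<sigma>. \<forall>x \<in> trm_vars u. \<sigma> x \<in> R x}"

definition atom_instances ::
    "('v \<Rightarrow> ('f, 'v) trm set) \<Rightarrow> ('f, 'p, 'v) atom \<Rightarrow> ('f, 'p, 'v) atom set"
  where "atom_instances R A = {subst_atom \<sigma> A | \<sigma>. \<forall>x \<in> atom_vars A. \<sigma> x \<in> R x}"

lemma subst_trm_cong:
  "(\<And>x. x \<in> trm_vars t \<Longrightarrow> \<sigma> x = \<tau> x) \<Longrightarrow> subst_trm \<sigma> t = subst_trm \<tau> t"
  by (induction t) (auto simp: trm_vars_def)

lemma subst_trm_ground_iff:
  "subst_trm \<sigma> t \<in> ground_trms \<Sigma> \<longleftrightarrow> trm_over \<Sigma> t \<and> (\<forall>x \<in> trm_vars t. \<sigma> x \<in> ground_trms \<Sigma>)"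
proof (induction t)
  case (Fun f ts)
  then show ?case by (auto simp: Fun_ground_iff trm_vars_def)
qed (auto simp: ground_trms_def trm_vars_def)

lemma subst_atom_ground_iff:
  "subst_atom \<sigma> A \<in> ground_atoms \<Sigma> \<longleftrightarrow> atom_over \<Sigma> A \<and> (\<forall>x \<in> atom_vars A. \<sigma> x \<in> ground_trms \<Sigma>)"
  by (cases A) (auto simp: Atom_ground_iff atom_vars_def subst_trm_ground_iff trm_vars_def)

text \<open>Linearity allows the substitutions matching the individual arguments to be glued together.\<close>

lemma linear_list_instances:
  assumes "distinct (concat (map trm_var_occs us))"
  shows "(\<exists>\<sigma>. ts = map (subst_trm \<sigma>) us \<and> (\<forall>u \<in> set us. \<forall>x \<in> trm_vars u. \<sigma> x \<in> R x)) \<longleftrightarrow>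
    list_all2 (\<lambda>u t. t \<in> trm_instances R u) us ts"
  using assms
proof (induction us arbitrary: ts)
  case Nil
  then show ?case by auto
next
  case (Cons u us)
  have IH: "(\<exists>\<sigma>. ts = map (subst_trm \<sigma>) us \<and> (\<forall>u \<in> set us. \<forall>x \<in> trm_vars u. \<sigma> x \<in> R x)) \<longleftrightarrow>
      list_all2 (\<lambda>u t. t \<in> trm_instances R u) us ts" for ts
    using Cons.prems by (intro Cons.IH) auto
  show ?case
  proof
    assume "\<exists>\<sigma>. ts = map (subst_trm \<sigma>) (u # us) \<and>
      (\<forall>u \<in> set (u # us). \<forall>x \<in> trm_vars u. \<sigma> x \<in> R x)"
    then obtain \<sigma> where "ts = map (subst_trm \<sigma>) (u # us)"
      and "\<forall>v \<in> set (u # us). \<forall>x \<in> trm_vars v. \<sigma> x \<in> R x"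
      by blast
    \<comment> \<open>The conjunct on \<open>v\<close> is carried along because
      \<open>\<sigma>\<close> is known to respect \<open>R\<close> only on the variables of listed
      terms.\<close>
    then have "list_all2 (\<lambda>v t. t = subst_trm \<sigma> v \<and> v \<in> set (u # us)) (u # us) ts"
      and "\<And>v. v \<in> set (u # us) \<Longrightarrow> subst_trm \<sigma> v \<in> trm_instances R v"
      by (auto simp: list_all2_map2 list_all2_same trm_instances_def)
    then show "list_all2 (\<lambda>u t. t \<in> trm_instances R u) (u # us) ts"
      by (auto elim: list_all2_mono)
  next
    assume "list_all2 (\<lambda>u t. t \<in> trm_instances R u) (u # us) ts"
    then obtain t ts' where ts: "ts = t # ts'" and t: "t \<in> trm_instances R u"
      and "list_all2 (\<lambda>u t. t \<in> trm_instances R u) us ts'"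
      by (auto simp: list_all2_Cons1)
    then obtain \<tau> where \<tau>: "ts' = map (subst_trm \<tau>) us"
      "\<forall>u \<in> set us. \<forall>x \<in> trm_vars u. \<tau> x \<in> R x"
      using IH by blast
    from t obtain \<rho> where \<rho>: "t = subst_trm \<rho> u" "\<forall>x \<in> trm_vars u. \<rho> x \<in> R x"
      by (auto simp: trm_instances_def)
    \<comment> \<open>Linearity of the list keeps the variables of \<open>u\<close> out of
      \<open>us\<close>, so using \<open>\<rho>\<close> on them leaves the match of the tail by
      \<open>\<tau>\<close> intact.\<close>
    define \<sigma> where "\<sigma> x = (if x \<in> trm_vars u then \<rho> x else \<tau> x)" for x
    have disj: "x \<notin> trm_vars u" if "x \<in> trm_vars v" "v \<in> set us" for x v
      using that Cons.prems by (auto simp: trm_vars_def)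
    have "subst_trm \<sigma> u = subst_trm \<rho> u"
      by (rule subst_trm_cong) (simp add: \<sigma>_def)
    moreover have "subst_trm \<sigma> v = subst_trm \<tau> v" if "v \<in> set us" for v
      using disj that by (intro subst_trm_cong) (auto simp: \<sigma>_def)
    ultimately have "ts = map (subst_trm \<sigma>) (u # us)"
      using ts \<tau>(1) \<rho>(1) by simp
    moreover have "\<forall>v \<in> set (u # us). \<forall>x \<in> trm_vars v. \<sigma> x \<in> R x"
      using \<tau>(2) \<rho>(2) by (auto simp: \<sigma>_def)
    ultimately show "\<exists>\<sigma>. ts = map (subst_trm \<sigma>) (u # us) \<and>
      (\<forall>u \<in> set (u # us). \<forall>x \<in> trm_vars u. \<sigma> x \<in> R x)" by blast
  qed
qed

text \<open>Here linearity is essential: a pattern such as \<open>f(x, x)\<close> would also demand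
  that the two arguments agree, which is not a condition on each argument alone.\<close>

lemma Fun_in_trm_instances_iff:
  assumes "linear_trm (Fun f us)"
  shows "Fun g ts \<in> trm_instances R (Fun f us) \<longleftrightarrow>
    g = f \<and> list_all2 (\<lambda>u t. t \<in> trm_instances R u) us ts"
proof -
  have "distinct (concat (map trm_var_occs us))"
    using assms by (simp add: linear_trm_def)
  then show ?thesis
    by (auto simp: linear_list_instances[symmetric] trm_instances_def[of R "Fun f us"] trm_vars_def)
qed

lemma Atom_in_atom_instances_iff:
  assumes "linear_atom (Atom q us)"
  shows "Atom p ts \<in> atom_instances R (Atom q us) \<longleftrightarrow>
    p = q \<and> list_all2 (\<lambda>u t. t \<in> trm_instances R u) us ts"
proof -
  have "distinct (concat (map trm_var_occs us))"
    using assms by (simp add: linear_atom_def)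
  then show ?thesis
    by (auto simp: linear_list_instances[symmetric] atom_instances_def atom_vars_def trm_vars_def)
qed

lemma distinct_concat_mem: "distinct (concat xss) \<Longrightarrow> xs \<in> set xss \<Longrightarrow> distinct xs"
  by (induction xss) auto

text \<open>Induction on the pattern. A variable contributes \<open>R x\<close>; a compound pattern
  adds one language to a closed family that contains the languages of its arguments.\<close>

lemma recognizable_trm_instances:
  assumes "linear_trm u" and "\<And>x. x \<in> trm_vars u \<Longrightarrow> recognizable \<Sigma> (R x)"
  shows "recognizable \<Sigma> (trm_instances R u)"
  using assms
proof (induction u)
  case (Var x)
  have "trm_instances R (Var x) = R x"
    by (auto simp: trm_instances_def trm_vars_def)
  with Var show ?case by (simp add: trm_vars_def)
next
  case (Fun f us)
  have "recognizable \<Sigma> (trm_instances R u)" if u: "u \<in> set us" for u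
  proof (rule Fun.IH[OF u])
    show "linear_trm u"
      using Fun.prems(1) u by (auto simp: linear_trm_def intro: distinct_concat_mem)
    show "recognizable \<Sigma> (R x)" if "x \<in> trm_vars u" for x
      using Fun.prems(2)[of x] u that by (auto simp: trm_vars_def)
  qed
  then obtain F where F: "closed_family \<Sigma> F" and sub: "trm_instances R ` set us \<subseteq> F"
    using recognizable_subset_closed[of "trm_instances R ` set us" \<Sigma>] by blast
  let ?L = "trm_instances R (Fun f us)"
  have "closed_family \<Sigma> (insert ?L F)"
  proof (rule closed_family_insert[OF F])
    fix g ts ss
    assume E: "list_all2 (indist \<Sigma> F) ts ss" and ts: "Fun g ts \<in> ?L"
    show "Fun g ss \<in> ?L"
      using ts unfolding Fun_in_trm_instances_iff[OF Fun.prems(1)]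
      \<comment> \<open>Every argument is tested against a language of \<open>F\<close>, and
        indistinguishable arguments pass the same tests.\<close>
      by (auto elim!: list_all2_transfer_left[OF E]) (use sub in \<open>auto simp: indist_def\<close>)
  qed
  then show ?case
    by (rule recognizableI) (auto simp: indist_def)
qed

lemma recognizable_atom_instances:
  assumes "linear_atom A" and "\<And>x. x \<in> atom_vars A \<Longrightarrow> recognizable \<Sigma> (R x)"
  shows "recognizable_atoms \<Sigma> (atom_instances R A)"
proof (cases A)
  case A: (Atom q us)
  have "recognizable \<Sigma> (trm_instances R u)" if u: "u \<in> set us" for u
  proof (rule recognizable_trm_instances)
    show "linear_trm u"
      using assms(1) u A by (auto simp: linear_atom_def linear_trm_def intro: distinct_concat_mem)
    show "recognizable \<Sigma> (R x)" if "x \<in> trm_vars u" for x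
      using assms(2)[of x] u that A by (auto simp: trm_vars_def atom_vars_def)
  qed
  then obtain F where F: "closed_family \<Sigma> F" and sub: "trm_instances R ` set us \<subseteq> F"
    using recognizable_subset_closed[of "trm_instances R ` set us" \<Sigma>] by blast
  have "Atom p ss \<in> atom_instances R A"
    if E: "list_all2 (indist \<Sigma> F) ts ss" and ts: "Atom p ts \<in> atom_instances R A" for p ts ss
    using ts unfolding A Atom_in_atom_instances_iff[OF assms(1)[unfolded A]]
    by (auto elim!: list_all2_transfer_left[OF E]) (use sub in \<open>auto simp: indist_def\<close>)
  then show ?thesis
    unfolding recognizable_atoms_def using F list_all2_indist_sym by blast
qed


section \<open>The three formalisms\<close>

text \<open>A ground instance forces \<open>\<delta>\<close> to be ground on the variables of
  \<open>u\<close>.\<close>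

lemma instance_iff_trm_instances:
  assumes "t \<in> ground_trms \<Sigma>"
  shows "(\<exists>\<delta>. t = subst_trm \<delta> u) \<longleftrightarrow> t \<in> trm_instances (\<lambda>_. ground_trms \<Sigma>) u"
  using assms by (auto simp: trm_instances_def subst_trm_ground_iff)

lemma instance_iff_atom_instances:
  assumes "set ts \<subseteq> ground_trms \<Sigma>"
  shows "(\<exists>\<tau>. Atom p ts = subst_atom \<tau> B) \<longleftrightarrow> Atom p ts \<in> atom_instances (\<lambda>_. ground_trms \<Sigma>) B"
  using assms
  by (cases B) (fastforce simp: atom_instances_def atom_vars_def trm_vars_def
      subst_trm_ground_iff[unfolded trm_vars_def])

text \<open>Each disequality has its own \<open>\<delta>\<close> and concerns the value of one
  variable of \<open>A\<close>, so all of them can be absorbed into \<open>R\<close>.\<close>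

lemma recognizable_adc:
  assumes "linear_adc \<Sigma> K"
  shows "recognizable_atoms \<Sigma> (adc_generated \<Sigma> K)"
proof (cases K)
  case K: (Pair A cs)
  define R where "R x = {s \<in> ground_trms \<Sigma>. \<forall>(y, t) \<in> set cs. y = x \<longrightarrow> \<not> (\<exists>\<delta>. s = subst_trm \<delta> t)}" for x
  have A: "atom_over \<Sigma> A" "linear_atom A"
    and cs: "\<And>x t. (x, t) \<in> set cs \<Longrightarrow> x \<in> atom_vars A \<and> linear_trm t"
    using assms by (auto simp: K linear_adc_def)
  have "recognizable \<Sigma> (R x)" for x
  proof (rule recognizable_determined)
    show "finite ((\<lambda>(y, t). trm_instances (\<lambda>_. ground_trms \<Sigma>) t) ` set cs)" by simp
    show "recognizable \<Sigma> L" if "L \<in> (\<lambda>(y, t). trm_instances (\<lambda>_. ground_trms \<Sigma>) t) ` set cs" for L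
      using that cs by (auto intro!: recognizable_trm_instances recognizable_ground)
    show "t \<in> R x"
      if "indist \<Sigma> ((\<lambda>(y, t). trm_instances (\<lambda>_. ground_trms \<Sigma>) t) ` set cs) s t" and "s \<in> R x" for s t
      using that unfolding R_def indist_def
      by (simp add: instance_iff_trm_instances cong: conj_cong) fastforce
  qed
  then have "recognizable_atoms \<Sigma> (atom_instances R A)"
    using A by (intro recognizable_atom_instances)
  \<comment> \<open>The constrained variables occur in \<open>A\<close>, so quantifying over the
    variables of \<open>A\<close> covers every constraint.\<close>
  moreover have "adc_generated \<Sigma> K = atom_instances R A"
    using A cs unfolding adc_generated_def K atom_instances_def R_def subst_atom_ground_iff prod.case
    by (intro Collect_cong ex_cong1 conj_cong refl) fast
  ultimately show ?thesis by simp
qed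

text \<open>An exclusion may restrict several arguments jointly, as in P(x,y)/{P(a,a)}, so it cannot
  be encoded in \<open>R\<close>. It is instead a Boolean combination of instance sets of linear
  atoms.\<close>

lemma recognizable_ig:
  assumes "linear_ig \<Sigma> K"
  shows "recognizable_atoms \<Sigma> (ig_generated \<Sigma> K)"
proof (cases K)
  case K: (Pair A Bs)
  let ?inst = "atom_instances (\<lambda>_. ground_trms \<Sigma>)"
  have A: "atom_over \<Sigma> A" "linear_atom A" and Bs: "finite Bs" "\<And>B. B \<in> Bs \<Longrightarrow> linear_atom B"
    using assms by (auto simp: K linear_ig_def)
  have gen: "Atom p ts \<in> ig_generated \<Sigma> K \<longleftrightarrow>
      Atom p ts \<in> ?inst A \<and> (\<forall>B \<in> Bs. Atom p ts \<notin> ?inst B)"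
    if "set ts \<subseteq> ground_trms \<Sigma>" for p ts
  proof -
    have "Atom p ts \<in> ground_instances \<Sigma> A \<longleftrightarrow> Atom p ts \<in> ?inst A"
      using A(1) unfolding ground_instances_def atom_instances_def subst_atom_ground_iff by blast
    then show ?thesis
      unfolding ig_generated_def K using instance_iff_atom_instances[OF that, of p] by auto
  qed
  show ?thesis
  proof (rule recognizable_atoms_determined)
    show "finite (?inst ` insert A Bs)" using Bs by simp
    show "recognizable_atoms \<Sigma> J" if "J \<in> ?inst ` insert A Bs" for J
      using that A Bs by (auto intro!: recognizable_atom_instances recognizable_ground)
    show "Atom p ss \<in> ig_generated \<Sigma> K"
      if "set ts \<subseteq> ground_trms \<Sigma>" "set ss \<subseteq> ground_trms \<Sigma>"
        "\<forall>J \<in> ?inst ` insert A Bs. Atom p ts \<in> J \<longleftrightarrow> Atom p ss \<in> J"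
        "Atom p ts \<in> ig_generated \<Sigma> K" for p ts ss
      using that by (simp add: gen)
  qed
qed

lemma state_accepts_Fun_iff:
  "state_accepts T q (Fun f ts) \<longleftrightarrow>
    (\<exists>qs. (f, qs, q) \<in> rules T \<and> list_all2 (state_accepts T) qs ts)"
  by (subst state_accepts.simps) auto

text \<open>Whether a state accepts \<open>Fun f ts\<close> depends only on which states accept each
  argument. The classes thus correspond to sets of states, as in the subset construction.\<close>

lemma recognizable_ta:
  assumes T: "ta_over \<Sigma> T"
  shows "recognizable \<Sigma> {t :: ('f, 'v) trm. ta_accepts T t}"
proof -
  define F :: "('f, 'v) trm set set"
    where "F = (\<lambda>q. {t. state_accepts T q t}) ` states T"
  have "closed_family \<Sigma> F"
  proof (rule closed_familyI)
    show "finite F" using T by (simp add: F_def ta_over_def)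
  next
    fix L f ts ss
    assume "L \<in> F" and E: "list_all2 (indist \<Sigma> F) ts ss" and "Fun f ts \<in> L"
    then obtain q qs where L: "L = {t. state_accepts T q t}" and r: "(f, qs, q) \<in> rules T"
      and acc: "list_all2 (state_accepts T) qs ts"
      by (auto simp: F_def state_accepts_Fun_iff)
    have "set qs \<subseteq> states T" using T r by (auto simp: ta_over_def)
    then have "list_all2 (state_accepts T) qs ss"
      by (intro list_all2_transfer_left[OF E acc]) (auto simp: F_def indist_def)
    with L r show "Fun f ss \<in> L" by (auto simp: state_accepts_Fun_iff)
  qed
  then show ?thesis
  proof (rule recognizableI)
    show "t \<in> {t. ta_accepts T t}" if "indist \<Sigma> F s t" "s \<in> {t. ta_accepts T t}" for s t
      using that T by (auto simp: ta_over_def ta_accepts_def indist_def F_def)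
  qed
qed

text \<open>The membership constraint concerns only the value of \<open>x\<close>, which occurs in
  \<open>A\<close>, so it becomes the component \<open>R x\<close>; other variables range over all
  ground terms.\<close>

lemma recognizable_amc:
  fixes K :: "('f, 'p, 'v, 'q) amc"
  assumes "linear_amc \<Sigma> K"
  shows "recognizable_atoms \<Sigma> (amc_generated \<Sigma> K)"
proof (cases K)
  case K: (fields A x T)
  define R :: "'v \<Rightarrow> ('f, 'v) trm set"
    where "R y = {s \<in> ground_trms \<Sigma>. y = x \<longrightarrow> ta_accepts T s}" for y
  have A: "atom_over \<Sigma> A" "linear_atom A" "x \<in> atom_vars A" "ta_over \<Sigma> T"
    using assms by (auto simp: K linear_amc_def)
  have "recognizable \<Sigma> (R y)" for y
    by (rule recognizable_determined[of "{{t. ta_accepts T t}}"])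
      (use A recognizable_ta in \<open>auto simp: R_def indist_def\<close>)
  then have "recognizable_atoms \<Sigma> (atom_instances R A)"
    using A by (intro recognizable_atom_instances)
  moreover have "amc_generated \<Sigma> K = atom_instances R A"
    using A unfolding amc_generated_def K atom_instances_def R_def subst_atom_ground_iff prod.case
    by (intro Collect_cong ex_cong1 conj_cong refl) fast
  ultimately show ?thesis by simp
qed


section \<open>The finite quotient of the Herbrand interpretation\<close>

text \<open>A class is identified by the set of languages containing its terms. Numbering these
  finitely many sets gives domain elements of type \<open>nat\<close>, as the notion of finite model
  requires.\<close>

lemma closed_family_class_index:
  assumes "closed_family \<Sigma> F"
  obtains k :: "('f, 'v) trm \<Rightarrow> nat" where
    "finite (k ` ground_trms \<Sigma>)"
    and "\<And>s t. s \<in> ground_trms \<Sigma> \<Longrightarrow> t \<in> ground_trms \<Sigma> \<Longrightarrow> k s = k t \<longleftrightarrow> indist \<Sigma> F s t"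
proof -
  have "finite (Pow F)"
    using assms by (simp add: closed_family_finite)
  then obtain e :: "('f, 'v) trm set set \<Rightarrow> nat" where e: "inj_on e (Pow F)"
    using finite_imp_inj_to_nat_seg by metis
  define k where "k t = e {L \<in> F. t \<in> L}" for t
  have "k ` ground_trms \<Sigma> \<subseteq> e ` Pow F" by (auto simp: k_def)
  then have "finite (k ` ground_trms \<Sigma>)"
    using \<open>finite (Pow F)\<close> by (meson finite_imageI finite_subset)
  moreover have "k s = k t \<longleftrightarrow> indist \<Sigma> F s t"
    if "s \<in> ground_trms \<Sigma>" "t \<in> ground_trms \<Sigma>" for s t
  proof -
    have "k s = k t \<longleftrightarrow> {L \<in> F. s \<in> L} = {L \<in> F. t \<in> L}"
      unfolding k_def by (rule inj_on_eq_iff[OF e]) auto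
    then show ?thesis using that by (auto simp: indist_def)
  qed
  ultimately show thesis using that by blast
qed

text \<open>Atoms have equal truth values under a valuation in the quotient and under its lift to
  ground terms. This equivalence carries over negative literals as well as positive ones.\<close>

lemma recognizable_atoms_finite_model:
  fixes I :: "('f, 'p, 'v) atom set" and N :: "('f, 'p, 'v) literal set set"
  assumes \<Sigma>: "finite_sig_with_constant \<Sigma>" and I: "recognizable_atoms \<Sigma> I"
    and N: "clause_set_over \<Sigma> N" and sat: "satisfies (herbrand \<Sigma> I) N"
  shows "has_finite_model \<Sigma> N"
proof -
  let ?G = "ground_trms \<Sigma> :: ('f, 'v) trm set"
  from I obtain F where F: "closed_family \<Sigma> F"
    and resp: "\<And>p ts ss. list_all2 (indist \<Sigma> F) ts ss \<Longrightarrow> Atom p ts \<in> I \<longleftrightarrow> Atom p ss \<in> I"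
    unfolding recognizable_atoms_def by blast
  obtain k :: "('f, 'v) trm \<Rightarrow> nat" where fin: "finite (k ` ?G)"
    and k: "\<And>s t. s \<in> ?G \<Longrightarrow> t \<in> ?G \<Longrightarrow> k s = k t \<longleftrightarrow> indist \<Sigma> F s t"
    using closed_family_class_index[OF F] by blast
  \<comment> \<open>\<open>r\<close> picks a representative of each class; the operations of
    \<open>\<M>\<close> are computed on representatives.\<close>
  define r where "r = inv_into ?G k"
  have r: "r d \<in> ?G" "k (r d) = d" if "d \<in> k ` ?G" for d
    using that unfolding r_def by (auto intro: inv_into_into f_inv_into_f)
  define \<M> where "\<M> = \<lparr>dom = k ` ?G, fun_interp = (\<lambda>f ds. k (Fun f (map r ds))),
    pred_interp = (\<lambda>p ds. Atom p (map r ds) \<in> I)\<rparr>"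
  have \<M>_sel: "fun_interp \<M> f ds = k (Fun f (map r ds))"
    "pred_interp \<M> p ds \<longleftrightarrow> Atom p (map r ds) \<in> I" for f p ds
    by (simp_all add: \<M>_def)
  \<comment> \<open>Replacing arguments by the representatives of their classes stays within the
    classes, which makes the choice of \<open>r\<close> harmless.\<close>
  have rk: "list_all2 (indist \<Sigma> F) (map r (map k ts)) ts" if "set ts \<subseteq> ?G" for ts
  proof -
    have "indist \<Sigma> F (r (k t)) t" if "t \<in> ?G" for t
      using that k[of "r (k t)" t] r[of "k t"] by simp
    then show ?thesis
      using that by (simp add: list_all2_map1 list_all2_same subset_iff)
  qed
  \<comment> \<open>The constant is what makes the domain nonempty.\<close>
  from \<Sigma> obtain c where "c \<in> funs \<Sigma>" "fun_arity \<Sigma> c = 0"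
    by (auto simp: finite_sig_with_constant_def)
  then have "Fun c [] \<in> ?G" by (simp add: Fun_ground_iff)
  then have "?G \<noteq> {}" by blast
  then have \<M>: "interp_over \<Sigma> \<M>"
    by (auto simp: interp_over_def \<M>_def Fun_ground_iff intro!: imageI r)
  have value_ground: "subst_trm \<sigma> t \<in> ?G" if "trm_over \<Sigma> t" "range \<sigma> \<subseteq> ?G" for t \<sigma>
    using that by (auto simp: subst_trm_ground_iff)
  \<comment> \<open>Evaluation in the quotient yields the class of the ground instance under the
    lifted valuation \<open>r \<circ> \<nu>\<close>.\<close>
  have trm_quotient: "trm_value \<M> \<nu> t = k (subst_trm (r \<circ> \<nu>) t)"
    if "trm_over \<Sigma> t" "range \<nu> \<subseteq> k ` ?G" for \<nu> t
    using that(1)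
  proof (induction t)
    case (Var x)
    then show ?case using that(2) r(2) by (simp add: range_subsetD)
  next
    case (Fun f ts)
    let ?ts = "map (subst_trm (r \<circ> \<nu>)) ts"
    have ts: "set ?ts \<subseteq> ?G"
      using Fun.prems that(2) r(1) by (auto intro!: value_ground)
    have f: "f \<in> funs \<Sigma>" "length (map r (map k ?ts)) = fun_arity \<Sigma> f"
      using Fun.prems by auto
    have "map (trm_value \<M> \<nu>) ts = map k ?ts"
      using Fun by (auto simp: comp_def)
    then have "trm_value \<M> \<nu> (Fun f ts) = k (Fun f (map r (map k ?ts)))"
      by (simp only: trm_value.simps \<M>_sel)
    also have "\<dots> = k (Fun f ?ts)"
      using closed_familyD[OF F rk[OF ts] f] k unfolding indist_def by blast
    finally show ?case by (simp only: subst_trm.simps)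
  qed
  have trm_herbrand: "trm_value (herbrand \<Sigma> I) \<sigma> t = subst_trm \<sigma> t" for \<sigma> t
    by (induction t) (auto simp: herbrand_def)
  have atom_quotient: "atom_true \<M> \<nu> A \<longleftrightarrow> atom_true (herbrand \<Sigma> I) (r \<circ> \<nu>) A"
    if "atom_over \<Sigma> A" "range \<nu> \<subseteq> k ` ?G" for \<nu> and A :: "('f, 'p, 'v) atom"
  proof (cases A)
    case A: (Atom p ts)
    let ?ts = "map (subst_trm (r \<circ> \<nu>)) ts"
    have ts: "set ?ts \<subseteq> ?G"
      using that A r(1) by (auto intro!: value_ground)
    have "map (trm_value \<M> \<nu>) ts = map k ?ts"
      using that A trm_quotient by (auto simp: comp_def)
    then have "atom_true \<M> \<nu> A \<longleftrightarrow> Atom p (map r (map k ?ts)) \<in> I"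
      by (simp only: A atom_true.simps \<M>_sel)
    also have "\<dots> \<longleftrightarrow> Atom p ?ts \<in> I"
      by (rule resp[OF rk[OF ts]])
    also have "\<dots> \<longleftrightarrow> atom_true (herbrand \<Sigma> I) (r \<circ> \<nu>) A"
      by (simp add: A trm_herbrand cong: map_cong) (simp add: herbrand_def)
    finally show ?thesis .
  qed
  have "satisfies \<M> N"
    unfolding satisfies_def
  proof (intro ballI allI impI)
    fix C and \<nu> :: "'v \<Rightarrow> nat"
    assume C: "C \<in> N" and "range \<nu> \<subseteq> dom \<M>"
    then have \<nu>: "range \<nu> \<subseteq> k ` ?G" by (simp add: \<M>_def)
    then have "range (r \<circ> \<nu>) \<subseteq> dom (herbrand \<Sigma> I)"
      using r(1) by (auto simp: herbrand_def)
    then have "\<exists>L \<in> C. literal_true (herbrand \<Sigma> I) (r \<circ> \<nu>) L"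
      using sat C by (simp only: satisfies_def)
    then obtain L where L: "L \<in> C" "literal_true (herbrand \<Sigma> I) (r \<circ> \<nu>) L" ..
    moreover have "literal_over \<Sigma> L"
      using N C L by (auto simp: clause_set_over_def)
    ultimately have "literal_true \<M> \<nu> L"
      using atom_quotient[OF _ \<nu>] by (cases L) auto
    with L show "\<exists>L \<in> C. literal_true \<M> \<nu> L" by blast
  qed
  with \<M> fin show ?thesis
    unfolding has_finite_model_def by (intro exI[of _ \<M>]) (simp add: \<M>_def)
qed

theorem theorem8:
  fixes \<Sigma> :: "('f, 'p) sig"
    and I :: "('f, 'p, 'v) atom set"
    and N :: "('f, 'p, 'v) literal set set"
  assumes "finite_sig_with_constant \<Sigma>"
    and "(\<exists>M :: ('f, 'p, 'v) adc set.
            finite M \<and> (\<forall>K \<in> M. linear_adc \<Sigma> K) \<and> I = (\<Union>K \<in> M. adc_generated \<Sigma> K)) \<or>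
         (\<exists>M :: ('f, 'p, 'v) ig set.
            finite M \<and> (\<forall>K \<in> M. linear_ig \<Sigma> K) \<and> I = (\<Union>K \<in> M. ig_generated \<Sigma> K)) \<or>
         (\<exists>M :: ('f, 'p, 'v, 'q) amc set.
            finite M \<and> (\<forall>K \<in> M. linear_amc \<Sigma> K) \<and> I = (\<Union>K \<in> M. amc_generated \<Sigma> K))"
    and "clause_set_over \<Sigma> N"
    and "satisfies (herbrand \<Sigma> I) N"
  shows "has_finite_model \<Sigma> N"
proof -
  have "recognizable_atoms \<Sigma> I"
    using assms(2)
  \<comment> \<open>One goal remains per formalism, each with \<open>I\<close> a finite union of
    recognizable sets.\<close>
  proof (elim disjE exE conjE)
  qed (auto intro!: recognizable_atoms_Union intro: recognizable_adc recognizable_ig recognizable_amc)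
  then show ?thesis
    by (rule recognizable_atoms_finite_model[OF assms(1) _ assms(3,4)])
qed

end
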